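(* Suppose that $u$ and $u_n$, $n=1,2,\ldots$, are fuzzy sets in $F_{USCG}(\mathbb{R}^m)$. Then $H_{\rm end}(u_n,u)\to 0$ as $n\to\infty$ if and only if both of the following hold: (i) $u_n$ $\Gamma$-converges to $u$; and (ii) for each $\alpha\in(0,1]$, $\bigcup_{n=1}^{+\infty}[u_n]_\alpha$ is a bounded set in $\mathbb{R}^m$.
   Context: A fuzzy set on $\mathbb{R}^m$ is a function $u:\mathbb{R}^m\to[0,1]$. For $\alpha\in(0,1]$ its $\alpha$-cut is $[u]_\alpha=\{x\in\mathbb{R}^m: u(x)\ge\alpha\}$, and $[u]_0=\overline{\{x:u(x)>0\}}$. $F_{USCG}(\mathbb{R}^m)$ is the set of all upper semi-continuous fuzzy sets $u$ on $\mathbb{R}^m$ such that $[u]_\alpha$ is bounded for each $\alpha\in(0,1]$ (cuts may be empty). The endograph of $u$ is ${\rm end}\,u=\{(x,t)\in\mathbb{R}^m\times[0,1]:u(x)\ge t\}$, a nonempty closed set when $u$ is upper semi-continuous. The endograph metric is $H_{\rm end}(u,v)=H({\rm end}\,u,{\rm end}\,v)$, where $H(A,B)=\max\{H^*(A,B),H^*(B,A)\}$, $H^*(A,B)=\sup_{a\in A}\inf_{b\in B}d(a,b)$, is the Hausdorff metric on nonempty closed sets ($d$ the Euclidean distance). For sets $C_n$ in a metric space $X$, $\liminf_n C_n$ is the set of limits $x=\lim_n x_n$ with $x_n\in C_n$, and $\limsup_n C_n$ is the set of limits $x=\lim_j x_{n_j}$ with $x_{n_j}\in C_{n_j}$ along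 some subsequence. $\{C_n\}$ Kuratowski converges to $C$ if $C=\liminf_n C_n=\limsup_n C_n$. For upper semi-continuous fuzzy sets, $u_n$ $\Gamma$-converges to $u$ if ${\rm end}\,u_n$ Kuratowski converges to ${\rm end}\,u$ (in $\mathbb{R}^m\times[0,1]$). *)

theory Defs
  imports "HOL-Analysis.Analysis"
begin

text \<open>
  Fuzzy sets on \<open>\<real>\<^sup>m\<close> are functions \<open>real ^ 'm \<Rightarrow> real\<close> with values in \<open>{0..1}\<close>; here \<open>m = CARD('m)\<close>.
\<close>

definition fuzzy_set :: "(real ^ 'm \<Rightarrow> real) \<Rightarrow> bool" where
  "fuzzy_set u \<longleftrightarrow> (\<forall>x. u x \<in> {0..1})"

definition usc :: "('a::topological_space \<Rightarrow> real) \<Rightarrow> bool" where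
  "usc f \<longleftrightarrow> (\<forall>x. \<forall>c > f x. \<forall>\<^sub>F y in nhds x. f y < c)"

definition alpha_cut :: "(real ^ 'm \<Rightarrow> real) \<Rightarrow> real \<Rightarrow> (real ^ 'm) set" where
  "alpha_cut u \<alpha> = (if \<alpha> = 0 then closure {x. u x > 0} else {x. u x \<ge> \<alpha>})"

definition F_USCG :: "(real ^ 'm \<Rightarrow> real) set" where
  "F_USCG = {u. fuzzy_set u \<and> usc u \<and> (\<forall>\<alpha>\<in>{0<..1}. bounded (alpha_cut u \<alpha>))}"

text \<open>
  The distance on the product type is \<open>sqrt ((dist x y)\<^sup>2 + (dist s t)\<^sup>2)\<close>, i.e. the Euclidean
  distance of \<open>\<real>\<^sup>m \<times> \<real>\<close>.
\<close>

definition endograph :: "(real ^ 'm \<Rightarrow> real) \<Rightarrow> ((real ^ 'm) \<times> real) set" where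
  "endograph u = {(x, t). t \<in> {0..1} \<and> u x \<ge> t}"

text \<open>
  The Hausdorff distance takes values in \<open>[0, \<infinity>]\<close>, so that the supremum is meaningful also for
  unbounded sets.
\<close>

definition hausdorff_pre :: "'a::metric_space set \<Rightarrow> 'a set \<Rightarrow> ennreal" where
  "hausdorff_pre A B = (SUP a\<in>A. INF b\<in>B. ennreal (dist a b))"

definition hausdorff :: "'a::metric_space set \<Rightarrow> 'a set \<Rightarrow> ennreal" where
  "hausdorff A B = max (hausdorff_pre A B) (hausdorff_pre B A)"

definition H_end :: "(real ^ 'm \<Rightarrow> real) \<Rightarrow> (real ^ 'm \<Rightarrow> real) \<Rightarrow> ennreal" where
  "H_end u v = hausdorff (endograph u) (endograph v)"

text \<open>
  Kuratowski limits of subsets \<open>C n\<close> of the metric space carried by the set \<open>X\<close>. In the upper limit,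
  \<open>r\<close> enumerates the indices of the subsequence.
\<close>

definition kuratowski_liminf :: "'a::metric_space set \<Rightarrow> (nat \<Rightarrow> 'a set) \<Rightarrow> 'a set" where
  "kuratowski_liminf X C = {x \<in> X. \<exists>s. (\<forall>n. s n \<in> C n) \<and> s \<longlonglongrightarrow> x}"

definition kuratowski_limsup :: "'a::metric_space set \<Rightarrow> (nat \<Rightarrow> 'a set) \<Rightarrow> 'a set" where
  "kuratowski_limsup X C =
     {x \<in> X. \<exists>r s. strict_mono (r :: nat \<Rightarrow> nat) \<and> (\<forall>j. s j \<in> C (r j)) \<and> s \<longlonglongrightarrow> x}"

definition kuratowski_converges :: "'a::metric_space set \<Rightarrow> (nat \<Rightarrow> 'a set) \<Rightarrow> 'a set \<Rightarrow> bool" where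
  "kuratowski_converges X C D \<longleftrightarrow> D = kuratowski_liminf X C \<and> D = kuratowski_limsup X C"

definition Gamma_converges :: "(nat \<Rightarrow> real ^ 'm \<Rightarrow> real) \<Rightarrow> (real ^ 'm \<Rightarrow> real) \<Rightarrow> bool" where
  "Gamma_converges us u \<longleftrightarrow>
     kuratowski_converges (UNIV \<times> {0..1}) (\<lambda>n. endograph (us n)) (endograph u)"

end

theory Submission
  imports Defs
begin

text \<open>
  To closed limits, Hausdorff convergence is Kuratowski convergence made uniform, and the two agree
  as long as everything happens inside one compact set. An endograph is never compact, since it
  contains the whole ground \<open>\<real>\<^sup>m \<times> {0}\<close>. But the ground is common to all endographs, so
  a point of height at most \<open>\<epsilon>\<close> is always within \<open>\<epsilon>\<close> of every other endograph. Only the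
  points higher than \<open>\<epsilon>\<close> can obstruct uniformity, and they lie over the \<open>\<epsilon>\<close>-cuts. Condition
  (ii) places the \<open>\<epsilon>\<close>-cuts of all \<open>us n\<close> in one ball, so that the compact case applies:
  \<open>eventually_near_of_limsup\<close> and \<open>eventually_near_of_liminf\<close> give the two halves of the
  Hausdorff distance from the upper and the lower Kuratowski limit.

  Conversely, Hausdorff convergence of nonempty sets to a closed set implies Kuratowski convergence
  (\<open>kuratowski_converges_of_hausdorff\<close>), and upper semi-continuity makes the endograph
  closed (\<open>closed_endograph\<close>). Hausdorff convergence of the endographs also forces (ii): a point of
  height \<open>\<alpha>\<close> on the endograph of \<open>us n\<close> is eventually close to a point of height at least \<open>\<alpha> / 2\<close> on that of \<open>u\<close>, so that
  the \<open>\<alpha>\<close>-cut of \<open>us n\<close> stays near the bounded \<open>\<alpha> / 2\<close>-cut of \<open>u\<close>; the finitely many remaining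
  cuts are bounded by assumption.
\<close>

section \<open>The Hausdorff distance in terms of points\<close>

lemma near_of_hausdorff_pre_less:
  assumes "hausdorff_pre A B < ennreal e" "a \<in> A"
  shows "\<exists>b\<in>B. dist a b < e"
proof -
  have "(INF b\<in>B. ennreal (dist a b)) \<le> hausdorff_pre A B"
    unfolding hausdorff_pre_def using assms(2) by (rule SUP_upper)
  then have "(INF b\<in>B. ennreal (dist a b)) < ennreal e"
    using assms(1) by (rule le_less_trans)
  then obtain b where "b \<in> B" "ennreal (dist a b) < ennreal e"
    by (auto simp: INF_less_iff)
  then show ?thesis
    by (auto simp: ennreal_less_iff)
qed

lemma hausdorff_pre_le_of_near:
  assumes "\<And>a. a \<in> A \<Longrightarrow> \<exists>b\<in>B. dist a b \<le> e"
  shows "hausdorff_pre A B \<le> ennreal e"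
  unfolding hausdorff_pre_def
proof (rule SUP_least)
  fix a assume "a \<in> A"
  then obtain b where "b \<in> B" "dist a b \<le> e"
    using assms by blast
  then show "(INF b\<in>B. ennreal (dist a b)) \<le> ennreal e"
    by (intro INF_lower2[of b] ennreal_leI)
qed

lemma hausdorff_tendsto_0_iff:
  "(\<lambda>n. hausdorff (C n) D) \<longlonglongrightarrow> 0 \<longleftrightarrow>
    (\<forall>e>0. \<forall>\<^sub>F n in sequentially.
      (\<forall>a\<in>C n. \<exists>b\<in>D. dist a b < e) \<and> (\<forall>b\<in>D. \<exists>a\<in>C n. dist b a < e))"
    (is "?L \<longleftrightarrow> ?R")
proof
  assume L: ?L
  show ?R
  proof (intro allI impI)
    fix e :: real assume "0 < e"
    then have "\<forall>\<^sub>F n in sequentially. hausdorff (C n) D < ennreal e"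
      using L by (intro order_tendstoD(2)) auto
    then show "\<forall>\<^sub>F n in sequentially.
        (\<forall>a\<in>C n. \<exists>b\<in>D. dist a b < e) \<and> (\<forall>b\<in>D. \<exists>a\<in>C n. dist b a < e)"
      by eventually_elim (auto simp: hausdorff_def intro: near_of_hausdorff_pre_less)
  qed
next
  assume R: ?R
  show ?L
  proof (rule order_tendstoI)
    fix c :: ennreal assume "0 < c"
    then obtain c' where c': "0 < c'" "c' < c"
      using dense by blast
    then obtain e where e: "c' = ennreal e" "0 < e"
      by (cases c') auto
    have "\<forall>\<^sub>F n in sequentially.
        (\<forall>a\<in>C n. \<exists>b\<in>D. dist a b < e) \<and> (\<forall>b\<in>D. \<exists>a\<in>C n. dist b a < e)"
      using R \<open>0 < e\<close> by blast
    then show "\<forall>\<^sub>F n in sequentially. hausdorff (C n) D < c"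
    proof eventually_elim
      case (elim n)
      have "hausdorff_pre (C n) D \<le> ennreal e" "hausdorff_pre D (C n) \<le> ennreal e"
        using elim by (meson hausdorff_pre_le_of_near less_imp_le)+
      then show ?case
        using c' e by (auto simp: hausdorff_def)
    qed
  qed simp
qed

section \<open>Hausdorff and Kuratowski convergence in metric spaces\<close>

lemma kuratowski_liminf_subset_limsup: "kuratowski_liminf X C \<subseteq> kuratowski_limsup X C"
proof
  fix x assume "x \<in> kuratowski_liminf X C"
  then obtain s where "x \<in> X" "\<And>n. s n \<in> C n" "s \<longlonglongrightarrow> x"
    by (auto simp: kuratowski_liminf_def)
  moreover have "strict_mono (\<lambda>n::nat. n)"
    by (simp add: strict_mono_def)
  ultimately show "x \<in> kuratowski_limsup X C"
    unfolding kuratowski_limsup_def by blast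
qed

text \<open>
  A point of \<open>D\<close> is approximated by nearly nearest points of the \<open>C n\<close>. A limit of points of the
  \<open>C n\<close> is at distance \<open>0\<close> from \<open>D\<close>, hence in \<open>D\<close> because \<open>D\<close> is closed.
\<close>

lemma kuratowski_converges_of_hausdorff:
  fixes C :: "nat \<Rightarrow> 'a::metric_space set"
  assumes "closed D" "D \<subseteq> X" and ne: "\<And>n. C n \<noteq> {}"
    and lim: "(\<lambda>n. hausdorff (C n) D) \<longlonglongrightarrow> 0"
  shows "kuratowski_converges X C D"
proof -
  note near = lim[unfolded hausdorff_tendsto_0_iff, rule_format]
  have low: "D \<subseteq> kuratowski_liminf X C"
  proof
    fix x assume x: "x \<in> D"
    have "\<exists>y\<in>C n. dist x y < infdist x (C n) + inverse (real (Suc n))" for n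
      using ne[of n] cINF_less_iff[of "C n" "dist x" "infdist x (C n) + inverse (real (Suc n))"]
      by (simp add: infdist_notempty)
    then obtain s where s: "\<And>n. s n \<in> C n"
      "\<And>n. dist x (s n) < infdist x (C n) + inverse (real (Suc n))"
      by metis
    have "(\<lambda>n. infdist x (C n)) \<longlonglongrightarrow> 0"
    proof (rule tendstoI)
      fix e :: real assume "0 < e"
      from near[OF this] show "\<forall>\<^sub>F n in sequentially. dist (infdist x (C n)) 0 < e"
      proof eventually_elim
        case (elim n)
        then obtain a where "a \<in> C n" "dist x a < e"
          using x by blast
        then show ?case
          using infdist_le[of a "C n" x] infdist_nonneg[of x "C n"] by (simp add: dist_real_def)
      qed
    qed
    from tendsto_add[OF this LIMSEQ_inverse_real_of_nat]
    have "(\<lambda>n. infdist x (C n) + inverse (real (Suc n))) \<longlonglongrightarrow> 0"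
      by simp
    then have "(\<lambda>n. dist (s n) x) \<longlonglongrightarrow> 0"
      by (rule Lim_null_comparison[rotated])
         (use s(2) in \<open>simp add: dist_commute less_imp_le\<close>)
    then have "s \<longlonglongrightarrow> x"
      by (rule tendsto_dist_iff[THEN iffD2])
    then show "x \<in> kuratowski_liminf X C"
      using s(1) x \<open>D \<subseteq> X\<close> unfolding kuratowski_liminf_def by blast
  qed
  have up: "kuratowski_limsup X C \<subseteq> D"
  proof
    fix x assume "x \<in> kuratowski_limsup X C"
    then obtain r s where r: "strict_mono r" and s: "\<And>j. s j \<in> C (r j)" "s \<longlonglongrightarrow> x"
      by (auto simp: kuratowski_limsup_def)
    have "\<exists>y\<in>D. dist y x < e" if "0 < e" for e
    proof -
      have "\<forall>\<^sub>F n in sequentially. \<forall>a\<in>C n. \<exists>b\<in>D. dist a b < e / 2"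
        using near[of "e / 2"] that by (auto elim: eventually_mono)
      then have "\<forall>\<^sub>F j in sequentially. \<forall>a\<in>C (r j). \<exists>b\<in>D. dist a b < e / 2"
        using filterlim_subseq[OF r] by (rule eventually_compose_filterlim)
      moreover have "\<forall>\<^sub>F j in sequentially. dist (s j) x < e / 2"
        using s(2) that by (intro tendstoD) auto
      ultimately have "\<forall>\<^sub>F j in sequentially. \<exists>y\<in>D. dist y x < e"
      proof eventually_elim
        case (elim j)
        then obtain b where "b \<in> D" "dist (s j) b < e / 2"
          using s(1) by blast
        then show ?case
          using elim(2) by (meson dist_triangle_half_r)
      qed
      then show ?thesis
        by simp
    qed
    then show "x \<in> D"
      using \<open>closed D\<close> closed_approachable by blast
  qed
  show ?thesis
    unfolding kuratowski_converges_def
    using low up kuratowski_liminf_subset_limsup[of X C] by blast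
qed

text \<open>
  If infinitely many \<open>C n\<close> had a point of \<open>K\<close> far from \<open>D\<close>, these points would accumulate by
  compactness, and the accumulation point, being in the upper limit, would lie in \<open>D\<close>.
\<close>

lemma eventually_near_of_limsup:
  fixes C :: "nat \<Rightarrow> 'a::metric_space set"
  assumes "compact K" "K \<subseteq> X" "kuratowski_limsup X C \<subseteq> D" "0 < e"
  shows "\<forall>\<^sub>F n in sequentially. \<forall>a\<in>C n \<inter> K. \<exists>b\<in>D. dist a b < e"
proof (rule ccontr)
  assume "\<not> ?thesis"
  then have "\<exists>\<^sub>F n in sequentially. \<exists>a\<in>C n \<inter> K. \<forall>b\<in>D. \<not> dist a b < e"
    by (simp add: not_eventually)
  then have inf: "infinite {n. \<exists>a\<in>C n \<inter> K. \<forall>b\<in>D. \<not> dist a b < e}"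
    by (simp add: frequently_cofinite flip: cofinite_eq_sequentially)
  define r where "r = enumerate {n. \<exists>a\<in>C n \<inter> K. \<forall>b\<in>D. \<not> dist a b < e}"
  have "strict_mono r"
    unfolding r_def using inf by (rule strict_mono_enumerate)
  have "\<exists>a. a \<in> C (r j) \<and> a \<in> K \<and> (\<forall>b\<in>D. \<not> dist a b < e)" for j
    using enumerate_in_set[OF inf, of j] unfolding r_def by blast
  then obtain s where s: "\<And>j. s j \<in> C (r j)" "\<And>j. s j \<in> K" "\<And>j b. b \<in> D \<Longrightarrow> \<not> dist (s j) b < e"
    by metis
  obtain x q where x: "x \<in> K" "strict_mono q" "(s \<circ> q) \<longlonglongrightarrow> x"
    using \<open>compact K\<close> s(2) unfolding compact_def by metis
  have "strict_mono (r \<circ> q)" "\<forall>j. (s \<circ> q) j \<in> C ((r \<circ> q) j)"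
    using \<open>strict_mono r\<close> x(2) s(1) by (simp_all add: strict_mono_o)
  then have "x \<in> kuratowski_limsup X C"
    using x \<open>K \<subseteq> X\<close> unfolding kuratowski_limsup_def by blast
  then have "x \<in> D"
    using assms(3) by blast
  obtain j where "dist ((s \<circ> q) j) x < e"
    using tendstoD[OF x(3) \<open>0 < e\<close>] eventually_happens'[OF sequentially_bot] by blast
  then show False
    using s(3)[OF \<open>x \<in> D\<close>] by simp
qed

text \<open>
  Each point of \<open>D\<close> is eventually close to \<open>C n\<close>; a finite \<open>e / 2\<close>-net of the compact part of \<open>D\<close>
  makes this uniform.
\<close>

lemma eventually_near_of_liminf:
  fixes C :: "nat \<Rightarrow> 'a::metric_space set"
  assumes "compact (D \<inter> K)" "D \<subseteq> kuratowski_liminf X C" "0 < e"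
  shows "\<forall>\<^sub>F n in sequentially. \<forall>b\<in>D \<inter> K. \<exists>a\<in>C n. dist b a < e"
proof -
  obtain F where F: "finite F" "F \<subseteq> D \<inter> K" "D \<inter> K \<subseteq> (\<Union>y\<in>F. ball y (e / 2))"
    using compactE_image[OF assms(1), of "D \<inter> K" "\<lambda>y. ball y (e / 2)"] \<open>0 < e\<close> by force
  have "\<forall>\<^sub>F n in sequentially. \<exists>a\<in>C n. dist a y < e / 2" if "y \<in> F" for y
  proof -
    obtain s where s: "\<And>n. s n \<in> C n" "s \<longlonglongrightarrow> y"
      using \<open>y \<in> F\<close> F(2) assms(2) by (force simp: kuratowski_liminf_def)
    have "\<forall>\<^sub>F n in sequentially. dist (s n) y < e / 2"
      using s(2) \<open>0 < e\<close> by (intro tendstoD) auto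
    then show ?thesis
      by eventually_elim (use s(1) in blast)
  qed
  then have "\<forall>\<^sub>F n in sequentially. \<forall>y\<in>F. \<exists>a\<in>C n. dist a y < e / 2"
    using F(1) by (simp add: eventually_ball_finite)
  then show ?thesis
  proof eventually_elim
    case (elim n)
    show ?case
    proof
      fix b assume "b \<in> D \<inter> K"
      then obtain y where y: "y \<in> F" "dist y b < e / 2"
        using F(3) by auto
      then obtain a where "a \<in> C n" "dist a y < e / 2"
        using elim by blast
      then show "\<exists>a\<in>C n. dist b a < e"
        using y(2) by (metis dist_commute dist_triangle_half_l)
    qed
  qed
qed

section \<open>Endographs\<close>

lemma alpha_cut_pos: "0 < \<alpha> \<Longrightarrow> alpha_cut u \<alpha> = {x. \<alpha> \<le> u x}"
  by (simp add: alpha_cut_def)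

lemma ground_in_endograph: "u \<in> F_USCG \<Longrightarrow> (x, 0) \<in> endograph u"
  by (simp add: F_USCG_def fuzzy_set_def endograph_def)

text \<open>
  If points \<open>(x\<^sub>n, t\<^sub>n)\<close> of the endograph tend to \<open>(x, t)\<close>, then \<open>u x < c < t\<close> is impossible: the
  values \<open>u x\<^sub>n\<close> would eventually be below \<open>c\<close> and the heights \<open>t\<^sub>n\<close> above it.
\<close>

lemma closed_endograph:
  assumes "usc u"
  shows "closed (endograph u)"
  unfolding closed_sequential_limits
proof -
  show "\<forall>s l. (\<forall>n. s n \<in> endograph u) \<and> s \<longlonglongrightarrow> l \<longrightarrow> l \<in> endograph u"
  proof safe
    fix s and x :: "real ^ 'a" and t :: real
    assume s: "\<forall>n. s n \<in> endograph u" and lim: "s \<longlonglongrightarrow> (x, t)"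
    have x: "(\<lambda>n. fst (s n)) \<longlonglongrightarrow> x" and t: "(\<lambda>n. snd (s n)) \<longlonglongrightarrow> t"
      using tendsto_fst[OF lim] tendsto_snd[OF lim] by simp_all
    have in01: "snd (s n) \<in> {0..1}" and le: "snd (s n) \<le> u (fst (s n))" for n
      using s[rule_format, of n] by (auto simp: endograph_def split: prod.splits)
    have "t \<in> {0..1}"
      using closed_sequentially[OF closed_atLeastAtMost in01 t] .
    moreover have "t \<le> u x"
    proof (rule dense_le)
      show "c \<le> u x" if "c < t" for c
      proof (rule ccontr)
        assume "\<not> c \<le> u x"
        then have "\<forall>\<^sub>F y in nhds x. u y < c"
          using assms by (simp add: usc_def)
        then have "\<forall>\<^sub>F n in sequentially. u (fst (s n)) < c"
          using x by (rule eventually_compose_filterlim)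
        moreover have "\<forall>\<^sub>F n in sequentially. c < snd (s n)"
          using order_tendstoD(1)[OF t that] .
        ultimately have "\<forall>\<^sub>F n in sequentially. False"
          by eventually_elim (use le in \<open>meson less_le_trans not_less_iff_gr_or_eq order_less_trans\<close>)
        then show False
          by simp
      qed
    qed
    ultimately show "(x, t) \<in> endograph u"
      by (simp add: endograph_def)
  qed
qed

text \<open>
  Sinking a low point to the ground moves it by its height only, and the ground lies in every
  endograph.
\<close>

lemma low_point_near_endograph:
  assumes "v \<in> F_USCG" "(x, t) \<in> endograph u" "t < e"
  shows "\<exists>b\<in>endograph v. dist (x, t) b < e"
  using assms ground_in_endograph[OF assms(1), of x]
  by (intro bexI[of _ "(x, 0)"]) (auto simp: dist_prod_def endograph_def)

text \<open>
  The level drops from \<open>\<alpha>\<close> to \<open>\<alpha> / 2\<close> because a nearby point of the endograph of \<open>u\<close> may be lower; it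
  must stay positive for the cut of \<open>u\<close> to be bounded.
\<close>

lemma bounded_alpha_cuts_of_hausdorff:
  assumes u: "u \<in> F_USCG" and us: "\<And>n. us n \<in> F_USCG"
    and lim: "(\<lambda>n. hausdorff (endograph (us n)) (endograph u)) \<longlonglongrightarrow> 0"
    and \<alpha>: "\<alpha> \<in> {0<..1}"
  shows "bounded (\<Union>n. alpha_cut (us n) \<alpha>)"
proof -
  have "bounded (alpha_cut u (\<alpha> / 2))"
    using u \<alpha> by (auto simp: F_USCG_def)
  then obtain R where R: "\<And>y. \<alpha> / 2 \<le> u y \<Longrightarrow> norm y \<le> R"
    using \<alpha> by (auto simp: bounded_iff alpha_cut_pos)
  have "\<forall>\<^sub>F n in sequentially. \<forall>a\<in>endograph (us n). \<exists>b\<in>endograph u. dist a b < \<alpha> / 2"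
    using lim[unfolded hausdorff_tendsto_0_iff, rule_format, of "\<alpha> / 2"] \<alpha>
    by (auto elim: eventually_mono)
  then obtain N where N: "\<And>n a. N \<le> n \<Longrightarrow> a \<in> endograph (us n) \<Longrightarrow>
      \<exists>b\<in>endograph u. dist a b < \<alpha> / 2"
    unfolding eventually_sequentially by blast
  have "alpha_cut (us n) \<alpha> \<subseteq> cball 0 (R + \<alpha> / 2)" if n: "N \<le> n" for n
  proof
    fix x assume "x \<in> alpha_cut (us n) \<alpha>"
    then have "(x, \<alpha>) \<in> endograph (us n)"
      using \<alpha> by (simp add: endograph_def alpha_cut_pos)
    then obtain y t where yt: "(y, t) \<in> endograph u" "dist (x, \<alpha>) (y, t) < \<alpha> / 2"
      using N[OF n, of "(x, \<alpha>)"] by fastforce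
    have "dist x y < \<alpha> / 2" "dist \<alpha> t < \<alpha> / 2"
      using dist_fst_le[of "(x, \<alpha>)" "(y, t)"] dist_snd_le[of "(x, \<alpha>)" "(y, t)"] yt(2) by auto
    then have "\<alpha> / 2 \<le> u y"
      using yt(1) by (auto simp: endograph_def dist_real_def abs_if split: if_splits)
    then have "norm y \<le> R"
      by (rule R)
    then show "x \<in> cball 0 (R + \<alpha> / 2)"
      using \<open>dist x y < \<alpha> / 2\<close> norm_triangle_sub[of x y] by (simp add: dist_norm)
  qed
  then have "(\<Union>n. alpha_cut (us n) \<alpha>) \<subseteq> (\<Union>n<N. alpha_cut (us n) \<alpha>) \<union> cball 0 (R + \<alpha> / 2)"
    using not_less by blast
  moreover have "bounded ((\<Union>n<N. alpha_cut (us n) \<alpha>) \<union> cball 0 (R + \<alpha> / 2))"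
    using us \<alpha> by (auto simp: F_USCG_def)
  ultimately show ?thesis
    by (rule bounded_subset[rotated])
qed

text \<open>
  The points of height at least \<open>\<epsilon>\<close> of all the endographs lie in one compact cylinder \<open>K\<close>, where
  Kuratowski convergence is uniform; the lower points are close to the ground.
\<close>

lemma hausdorff_endograph_of_Gamma:
  fixes u :: "real ^ 'm \<Rightarrow> real"
  assumes u: "u \<in> F_USCG" and us: "\<And>n. us n \<in> F_USCG"
    and conv: "Gamma_converges us u"
    and bdd: "\<And>\<alpha>. \<alpha> \<in> {0<..1} \<Longrightarrow> bounded (\<Union>n. alpha_cut (us n) \<alpha>)"
  shows "(\<lambda>n. hausdorff (endograph (us n)) (endograph u)) \<longlonglongrightarrow> 0"
  unfolding hausdorff_tendsto_0_iff
proof (intro allI impI)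
  fix e :: real assume e: "0 < e"
  (* The cuts are known to be bounded only at levels in (0, 1], so that e has to be truncated. *)
  define \<epsilon> where "\<epsilon> = min e 1"
  have \<epsilon>: "\<epsilon> \<in> {0<..1}" "\<epsilon> \<le> e"
    using e by (auto simp: \<epsilon>_def)
  let ?X = "(UNIV :: (real ^ 'm) set) \<times> {0..1::real}"
  have "bounded (alpha_cut u \<epsilon> \<union> (\<Union>n. alpha_cut (us n) \<epsilon>))"
    using u bdd \<epsilon>(1) by (auto simp: F_USCG_def)
  then obtain R where "\<forall>x\<in>alpha_cut u \<epsilon> \<union> (\<Union>n. alpha_cut (us n) \<epsilon>). norm x \<le> R"
    unfolding bounded_iff ..
  then have R: "\<epsilon> \<le> v x \<Longrightarrow> x \<in> cball 0 R" if "v = u \<or> v \<in> range us" for v x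
    using that \<epsilon>(1) by (auto simp: alpha_cut_pos subset_iff)
  define K where "K = cball (0 :: real ^ 'm) R \<times> {0..1::real}"
  have K: "compact K" "K \<subseteq> ?X"
    by (auto simp: K_def compact_Times)
  have high: "t < \<epsilon> \<or> (x, t) \<in> endograph v \<inter> K"
    if "(x, t) \<in> endograph v" "v = u \<or> v \<in> range us" for v x t
    using that(1) R[OF that(2), of x] by (cases "t < \<epsilon>") (auto simp: endograph_def K_def)
  have lim: "endograph u \<subseteq> kuratowski_liminf ?X (\<lambda>n. endograph (us n))"
    "kuratowski_limsup ?X (\<lambda>n. endograph (us n)) \<subseteq> endograph u"
    using conv by (auto simp: Gamma_converges_def kuratowski_converges_def)
  have "closed (endograph u)"
    using u by (simp add: F_USCG_def closed_endograph)
  then have "compact (endograph u \<inter> K)"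
    using K(1) by (rule closed_Int_compact)
  from eventually_near_of_limsup[OF K lim(2) e] eventually_near_of_liminf[OF this lim(1) e]
  show "\<forall>\<^sub>F n in sequentially.
      (\<forall>a\<in>endograph (us n). \<exists>b\<in>endograph u. dist a b < e) \<and>
      (\<forall>b\<in>endograph u. \<exists>a\<in>endograph (us n). dist b a < e)"
  proof eventually_elim
    case (elim n)
    have "\<exists>b\<in>endograph u. dist (x, t) b < e" if "(x, t) \<in> endograph (us n)" for x t
      using high[OF that] elim(1) low_point_near_endograph[OF u that, of e] \<epsilon>(2) by fastforce
    moreover have "\<exists>a\<in>endograph (us n). dist (x, t) a < e" if "(x, t) \<in> endograph u" for x t
      using high[OF that] elim(2) low_point_near_endograph[OF us that, of e n] \<epsilon>(2) by fastforce
    ultimately show ?case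
      by auto
  qed
qed

theorem theorem4p4:
  fixes u :: "real ^ 'm \<Rightarrow> real" and us :: "nat \<Rightarrow> real ^ 'm \<Rightarrow> real"
  assumes "u \<in> F_USCG" and "\<And>n. us n \<in> F_USCG"
  shows "(\<lambda>n. H_end (us n) u) \<longlonglongrightarrow> 0 \<longleftrightarrow>
    Gamma_converges us u \<and> (\<forall>\<alpha>\<in>{0<..1}. bounded (\<Union>n. alpha_cut (us n) \<alpha>))"
proof
  assume "(\<lambda>n. H_end (us n) u) \<longlonglongrightarrow> 0"
  then have lim: "(\<lambda>n. hausdorff (endograph (us n)) (endograph u)) \<longlonglongrightarrow> 0"
    by (simp add: H_end_def)
  have "closed (endograph u)"
    using assms(1) by (simp add: F_USCG_def closed_endograph)
  moreover have "endograph u \<subseteq> UNIV \<times> {0..1}"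
    by (auto simp: endograph_def)
  moreover have "endograph (us n) \<noteq> {}" for n
    using ground_in_endograph[OF assms(2)] by blast
  ultimately have "Gamma_converges us u"
    unfolding Gamma_converges_def using lim by (rule kuratowski_converges_of_hausdorff)
  then show "Gamma_converges us u \<and> (\<forall>\<alpha>\<in>{0<..1}. bounded (\<Union>n. alpha_cut (us n) \<alpha>))"
    using bounded_alpha_cuts_of_hausdorff[OF assms lim] by blast
next
  assume "Gamma_converges us u \<and> (\<forall>\<alpha>\<in>{0<..1}. bounded (\<Union>n. alpha_cut (us n) \<alpha>))"
  then show "(\<lambda>n. H_end (us n) u) \<longlonglongrightarrow> 0"
    using hausdorff_endograph_of_Gamma[OF assms] by (simp add: H_end_def)
qed

end
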